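(* Let $f:2^X\to\mathbb{R}_{\ge0}$ be monotone submodular and run MultipassLocalSearch$(\alpha,\beta_1,\dots,\beta_d)$ with $\alpha\ge0$, $\beta_1,\dots,\beta_d>0$, producing $S_0=\emptyset,S_1,\dots,S_d$. Let $1<i\le d$, suppose $f(S_i)>0$ and that $\gamma_{i-1}$ is a real number with $f(\mathit{OPT})\le\gamma_{i-1}f(S_{i-1})$, and define $\delta_i=f(S_{i-1})/f(S_i)$. Then \[ f(\mathit{OPT})\le\min\Bigl\{\gamma_{i-1}\delta_i,\ \Bigl(\frac{p}{\beta_i}+p-1\Bigr)(1-\delta_i)+p+\beta_ip+1\Bigr\}\cdot f(S_i)+k\alpha. \]
   Context: $X$ is a finite ground set; $f:2^X\to\mathbb{R}_{\ge 0}$ is submodular and monotone ($f(A)\le f(B)$ for $A\subseteq B$). For $e\in X$, $A\subseteq X$ write $f(e\mid A)=f(A\cup\{e\})-f(A)$. A $p$-matchoid on $X$ is a collection of matroids $\mathcal{M}_\ell=(X_\ell,\mathcal{I}_\ell)$, $X_\ell\subseteq X$, such that every element of $X$ lies in at most $p$ of the sets $X_\ell$; $S\subseteq X$ is feasible ($S\in\mathcal{I}$) iff $S\cap X_\ell\in\mathcal{I}_\ell$ for all $\ell$. The rank $k$ is the maximum size of a feasible set; $\mathit{OPT}$ is a feasible set maximizing $f$. Elements of $X$ arrive one at a time in a stream; every pass receives all of $X$. Incremental values: given a total order $\prec$ on $X$, $\nu(e,T)=f(e\mid\{t\in T:t\prec e\})$. Exchange$(x,S)$: start with $C_x=\emptyset$;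 for each $\mathcal{M}_\ell$ with $x\in X_\ell$, let $S_\ell=S\cap X_\ell$; if $S_\ell\cup\{x\}\notin\mathcal{I}_\ell$, let $T_\ell=\{y\in S_\ell:(S_\ell\setminus\{y\})\cup\{x\}\in\mathcal{I}_\ell\}$ and add to $C_x$ an element of $T_\ell$ minimizing $\nu(\cdot,S)$. Return $C_x$. StreamingLocalSearch$(\alpha,\beta,S_{\mathrm{init}})$: $S\leftarrow S_{\mathrm{init}}$; for each arriving $x$: if $x\in S_{\mathrm{init}}$ discard it; otherwise compute $C_x=$ Exchange$(x,S)$ and if $f(x\mid S)\ge\alpha+(1+\beta)\sum_{c\in C_x}\nu(c,S)$ set $S\leftarrow(S\setminus C_x)\cup\{x\}$, else reject $x$. Output the final $S$. The order $\prec$ for $\nu$ in a pass is the pretend order: elements of $S_{\mathrm{init}}$ first, in the same relative order as in the pretend order of the pass that produced $S_{\mathrm{init}}$, then elements of $X\setminus S_{\mathrm{init}}$ in arrival order. MultipassLocalSearch$(\alpha,\beta_1,\dots,\beta_d)$: $S_0=\emptyset$; for $i=1,\dots,d$, $S_i$ is the output of StreamingLocalSearch$(\alpha,\beta_i,S_{i-1})$ on a new pass. *)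

theory Defs
  imports Complex_Main
begin

section \<open>Submodular functions and matchoids\<close>

definition submodular_on :: "'a set \<Rightarrow> ('a set \<Rightarrow> real) \<Rightarrow> bool" where
  "submodular_on X f \<longleftrightarrow>
     (\<forall>A B. A \<subseteq> X \<longrightarrow> B \<subseteq> X \<longrightarrow> f (A \<union> B) + f (A \<inter> B) \<le> f A + f B)"

definition marginal :: "('a set \<Rightarrow> real) \<Rightarrow> 'a \<Rightarrow> 'a set \<Rightarrow> real" where
  "marginal f e A = f (A \<union> {e}) - f A"

locale matroid =
  fixes E :: "'a set" and \<I> :: "'a set set"
  assumes finite_ground: "finite E"
    and indep_subset_ground: "A \<in> \<I> \<Longrightarrow> A \<subseteq> E"
    and empty_indep: "{} \<in> \<I>"
    and hereditary: "A \<in> \<I> \<Longrightarrow> B \<subseteq> A \<Longrightarrow> B \<in> \<I>"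
    and augment: "A \<in> \<I> \<Longrightarrow> B \<in> \<I> \<Longrightarrow> card A < card B \<Longrightarrow> \<exists>x \<in> B - A. insert x A \<in> \<I>"

text \<open>A matchoid is a family of matroids \<open>(E l, \<I> l)\<close> with indices \<open>l \<in> L\<close>, so that the same
  matroid may occur several times. Finiteness is stated next to the cardinality bound because
  \<^const>\<open>card\<close> is 0 on infinite sets.\<close>

locale matchoid =
  fixes p :: nat and X :: "'a set" and L :: "'l set"
    and E :: "'l \<Rightarrow> 'a set" and \<I> :: "'l \<Rightarrow> 'a set set"
  assumes finite_X: "finite X"
    and matroid: "l \<in> L \<Longrightarrow> matroid (E l) (\<I> l)"
    and ground_subset: "l \<in> L \<Longrightarrow> E l \<subseteq> X"
    and multiplicity: "x \<in> X \<Longrightarrow> finite {l \<in> L. x \<in> E l} \<and> card {l \<in> L. x \<in> E l} \<le> p"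

definition feasible ::
    "'a set \<Rightarrow> 'l set \<Rightarrow> ('l \<Rightarrow> 'a set) \<Rightarrow> ('l \<Rightarrow> 'a set set) \<Rightarrow> 'a set \<Rightarrow> bool" where
  "feasible X L E \<I> S \<longleftrightarrow> S \<subseteq> X \<and> (\<forall>l\<in>L. S \<inter> E l \<in> \<I> l)"

definition matchoid_rank ::
    "'a set \<Rightarrow> 'l set \<Rightarrow> ('l \<Rightarrow> 'a set) \<Rightarrow> ('l \<Rightarrow> 'a set set) \<Rightarrow> nat" where
  "matchoid_rank X L E \<I> = Max (card ` {S. feasible X L E \<I> S})"


section \<open>A single pass of local search\<close>

text \<open>Orders are strict relations; \<open>prec s t\<close> means that \<open>s\<close> comes before \<open>t\<close>.\<close>

definition incr_value ::
    "('a set \<Rightarrow> real) \<Rightarrow> ('a \<Rightarrow> 'a \<Rightarrow> bool) \<Rightarrow> 'a \<Rightarrow> 'a set \<Rightarrow> real" where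
  "incr_value f prec e T = marginal f e {t \<in> T. prec t e}"

definition conflicts ::
    "'l set \<Rightarrow> ('l \<Rightarrow> 'a set) \<Rightarrow> ('l \<Rightarrow> 'a set set) \<Rightarrow> 'a \<Rightarrow> 'a set \<Rightarrow> 'l set" where
  "conflicts L E \<I> x S = {l \<in> L. x \<in> E l \<and> (S \<inter> E l) \<union> {x} \<notin> \<I> l}"

definition swap_candidates ::
    "('l \<Rightarrow> 'a set) \<Rightarrow> ('l \<Rightarrow> 'a set set) \<Rightarrow> 'a \<Rightarrow> 'a set \<Rightarrow> 'l \<Rightarrow> 'a set" where
  "swap_candidates E \<I> x S l = {y \<in> S \<inter> E l. ((S \<inter> E l) - {y}) \<union> {x} \<in> \<I> l}"

text \<open>\<open>exchange f prec L E \<I> x S C\<close> says that \<open>C\<close> is a possible result of the exchange procedure.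
  It is a relation because minimizers need not be unique; \<open>c l\<close> is the element picked for the
  matroid \<open>l\<close>, and different matroids may pick the same element.\<close>

definition exchange ::
    "('a set \<Rightarrow> real) \<Rightarrow> ('a \<Rightarrow> 'a \<Rightarrow> bool) \<Rightarrow>
     'l set \<Rightarrow> ('l \<Rightarrow> 'a set) \<Rightarrow> ('l \<Rightarrow> 'a set set) \<Rightarrow> 'a \<Rightarrow> 'a set \<Rightarrow> 'a set \<Rightarrow> bool" where
  "exchange f prec L E \<I> x S C \<longleftrightarrow>
     (\<exists>c. (\<forall>l \<in> conflicts L E \<I> x S.
             is_arg_min (\<lambda>y. incr_value f prec y S) (\<lambda>y. y \<in> swap_candidates E \<I> x S l) (c l))
        \<and> C = c ` conflicts L E \<I> x S)"

text \<open>The last alternative only concerns elements \<open>x\<close> that are loops in some matroid (\<open>{x} \<notin> \<I> l\<close>):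
  there the set of swap candidates is empty, no exchange is possible, and \<open>x\<close>, which lies in no
  feasible set, is rejected.\<close>

definition local_search_step ::
    "('a set \<Rightarrow> real) \<Rightarrow> ('a \<Rightarrow> 'a \<Rightarrow> bool) \<Rightarrow>
     'l set \<Rightarrow> ('l \<Rightarrow> 'a set) \<Rightarrow> ('l \<Rightarrow> 'a set set) \<Rightarrow> real \<Rightarrow> real \<Rightarrow> 'a set \<Rightarrow>
     'a \<Rightarrow> 'a set \<Rightarrow> 'a set \<Rightarrow> bool" where
  "local_search_step f prec L E \<I> \<alpha> \<beta> S\<^sub>i\<^sub>n\<^sub>i\<^sub>t x S S' \<longleftrightarrow>
     (if x \<in> S\<^sub>i\<^sub>n\<^sub>i\<^sub>t then S' = S
      else (\<exists>C. exchange f prec L E \<I> x S C \<and>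
                S' = (if marginal f x S \<ge> \<alpha> + (1 + \<beta>) * (\<Sum>c\<in>C. incr_value f prec c S)
                      then (S - C) \<union> {x} else S))
         \<or> ((\<nexists>C. exchange f prec L E \<I> x S C) \<and> S' = S))"

primrec local_search_run ::
    "('a set \<Rightarrow> real) \<Rightarrow> ('a \<Rightarrow> 'a \<Rightarrow> bool) \<Rightarrow>
     'l set \<Rightarrow> ('l \<Rightarrow> 'a set) \<Rightarrow> ('l \<Rightarrow> 'a set set) \<Rightarrow> real \<Rightarrow> real \<Rightarrow> 'a set \<Rightarrow>
     'a list \<Rightarrow> 'a set \<Rightarrow> 'a set \<Rightarrow> bool" where
  "local_search_run f prec L E \<I> \<alpha> \<beta> S\<^sub>i\<^sub>n\<^sub>i\<^sub>t [] S S' \<longleftrightarrow> S' = S"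
| "local_search_run f prec L E \<I> \<alpha> \<beta> S\<^sub>i\<^sub>n\<^sub>i\<^sub>t (x # xs) S S' \<longleftrightarrow>
     (\<exists>S''. local_search_step f prec L E \<I> \<alpha> \<beta> S\<^sub>i\<^sub>n\<^sub>i\<^sub>t x S S'' \<and>
            local_search_run f prec L E \<I> \<alpha> \<beta> S\<^sub>i\<^sub>n\<^sub>i\<^sub>t xs S'' S')"

definition streaming_local_search ::
    "('a set \<Rightarrow> real) \<Rightarrow> ('a \<Rightarrow> 'a \<Rightarrow> bool) \<Rightarrow>
     'l set \<Rightarrow> ('l \<Rightarrow> 'a set) \<Rightarrow> ('l \<Rightarrow> 'a set set) \<Rightarrow> real \<Rightarrow> real \<Rightarrow> 'a set \<Rightarrow>
     'a list \<Rightarrow> 'a set \<Rightarrow> bool" where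
  "streaming_local_search f prec L E \<I> \<alpha> \<beta> S\<^sub>i\<^sub>n\<^sub>i\<^sub>t xs S \<longleftrightarrow>
     local_search_run f prec L E \<I> \<alpha> \<beta> S\<^sub>i\<^sub>n\<^sub>i\<^sub>t xs S\<^sub>i\<^sub>n\<^sub>i\<^sub>t S"


section \<open>Several passes\<close>

definition arrives_before :: "'a list \<Rightarrow> 'a \<Rightarrow> 'a \<Rightarrow> bool" where
  "arrives_before xs s t \<longleftrightarrow> (\<exists>i j. i < j \<and> j < length xs \<and> xs ! i = s \<and> xs ! j = t)"

definition pretend_step ::
    "('a \<Rightarrow> 'a \<Rightarrow> bool) \<Rightarrow> 'a set \<Rightarrow> 'a list \<Rightarrow> 'a \<Rightarrow> 'a \<Rightarrow> bool" where
  "pretend_step prev S\<^sub>i\<^sub>n\<^sub>i\<^sub>t xs s t \<longleftrightarrow>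
     s \<in> S\<^sub>i\<^sub>n\<^sub>i\<^sub>t \<and> t \<in> S\<^sub>i\<^sub>n\<^sub>i\<^sub>t \<and> prev s t \<or>
     s \<in> S\<^sub>i\<^sub>n\<^sub>i\<^sub>t \<and> t \<notin> S\<^sub>i\<^sub>n\<^sub>i\<^sub>t \<or>
     s \<notin> S\<^sub>i\<^sub>n\<^sub>i\<^sub>t \<and> t \<notin> S\<^sub>i\<^sub>n\<^sub>i\<^sub>t \<and> arrives_before xs s t"

text \<open>\<open>xs i\<close> is the stream of pass \<open>i \<ge> 1\<close> and \<open>S i\<close> the output of that pass. The value at \<open>0\<close> is
  a dummy: pass 1 starts from \<open>S 0 = {}\<close>, so its pretend order is just its arrival order.\<close>

primrec pretend_order ::
    "(nat \<Rightarrow> 'a list) \<Rightarrow> (nat \<Rightarrow> 'a set) \<Rightarrow> nat \<Rightarrow> 'a \<Rightarrow> 'a \<Rightarrow> bool" where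
  "pretend_order xs S 0 = (\<lambda>s t. False)"
| "pretend_order xs S (Suc i) = pretend_step (pretend_order xs S i) (S i) (xs (Suc i))"

definition multipass_local_search ::
    "('a set \<Rightarrow> real) \<Rightarrow> 'l set \<Rightarrow> ('l \<Rightarrow> 'a set) \<Rightarrow> ('l \<Rightarrow> 'a set set) \<Rightarrow>
     real \<Rightarrow> (nat \<Rightarrow> real) \<Rightarrow> nat \<Rightarrow> (nat \<Rightarrow> 'a list) \<Rightarrow> (nat \<Rightarrow> 'a set) \<Rightarrow> bool" where
  "multipass_local_search f L E \<I> \<alpha> \<beta> d xs S \<longleftrightarrow>
     S 0 = {} \<and>
     (\<forall>i\<in>{1..d}. streaming_local_search f (pretend_order xs S i) L E \<I> \<alpha> (\<beta> i) (S (i - 1)) (xs i) (S i))"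

end

theory Submission
  imports Defs
begin

text \<open>Fix a pass that starts from \<open>S\<^sup>-\<close> and ends with \<open>S\<^sup>+\<close>, let \<open>A\<close> collect \<open>S\<^sup>-\<close> and all accepted
  elements, and let \<open>T\<close> be the sum over \<open>A - S\<^sup>+\<close> of the incremental values at the time of removal.
  The acceptance rule gives \<open>\<beta> T \<le> f S\<^sup>+ - f S\<^sup>-\<close>, and submodularity gives \<open>f A \<le> f S\<^sup>+ + T\<close>. A
  rejected \<open>x \<in> OPT\<close> has marginal value at most \<open>\<alpha> + (1 + \<beta>) \<Sum>\<^sub>l w x l\<close>, where \<open>w x l\<close> is the
  smallest value on its circuit in matroid \<open>l\<close>. Thus \<open>x\<close> is spanned in \<open>l\<close> by solution elements of
  value at least \<open>w x l\<close>, and this persists: an element removed because of \<open>l\<close> is spanned by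
  elements of no smaller value, one removed because of another matroid is kept with its value frozen,
  and the values of remaining elements only grow. As \<open>OPT\<close> is independent in \<open>l\<close>, comparing the
  numbers of elements above each threshold bounds \<open>\<Sum>\<^sub>x w x l\<close> by the total value of the elements
  never removed because of \<open>l\<close>. Summing over \<open>l\<close>, elements of \<open>S\<^sup>+\<close> count at most \<open>p\<close> times and
  removed ones at most \<open>p - 1\<close> times, so
  \<open>f OPT \<le> f S\<^sup>+ + T + k \<alpha> + (1 + \<beta>) (p f S\<^sup>+ + (p - 1) T)\<close>.
  For \<open>p = 0\<close> nothing is ever removed, and the claim is this inequality for the previous pass.\<close>

section \<open>Matroid closure\<close>

context matroid
begin

lemma finite_indep: "A \<in> \<I> \<Longrightarrow> finite A"
  using finite_ground indep_subset_ground finite_subset by blast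

definition basis_of :: "'a set \<Rightarrow> 'a set \<Rightarrow> bool" where
  "basis_of A B \<longleftrightarrow> B \<subseteq> A \<and> B \<in> \<I> \<and> (\<forall>x\<in>A - B. insert x B \<notin> \<I>)"

text \<open>The span operator, encoded through maximal independent subsets instead of a rank
  function. Ranging over all bases makes membership easy to use; \<open>clI\<close> shows that a
  single basis suffices to establish it.\<close>

definition cl :: "'a set \<Rightarrow> 'a set" where
  "cl A = {x \<in> E. \<forall>B. basis_of A B \<longrightarrow> x \<in> B \<or> insert x B \<notin> \<I>}"

lemma basis_of_indep: "B \<in> \<I> \<Longrightarrow> basis_of B B"
  by (auto simp: basis_of_def)

lemma extend_to_basis:
  assumes "B \<in> \<I>" "B \<subseteq> A"
  obtains K where "basis_of A K" "B \<subseteq> K"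
proof -
  have "finite {K \<in> \<I>. K \<subseteq> A}"
    by (rule finite_subset[of _ "Pow E"]) (use finite_ground indep_subset_ground in auto)
  from finite_has_maximal2[OF this, of B] assms
  obtain K where K: "K \<in> \<I>" "K \<subseteq> A" "B \<subseteq> K"
    and max: "\<And>J. J \<in> \<I> \<Longrightarrow> J \<subseteq> A \<Longrightarrow> K \<subseteq> J \<Longrightarrow> K = J"
    by auto
  have "basis_of A K"
    unfolding basis_of_def using K max[of "insert _ K"] by blast
  then show thesis using K that by blast
qed

lemma basis_of_exists: obtains B where "basis_of A B"
  using extend_to_basis[of "{}" A] empty_indep by auto

lemma basis_of_augment:
  assumes "basis_of A B" "J \<in> \<I>" "J \<subseteq> insert x A" "card B < card J"
  shows "x \<notin> B \<and> insert x B \<in> \<I>"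
proof -
  obtain z where "z \<in> J - B" "insert z B \<in> \<I>"
    using augment[of B J] assms unfolding basis_of_def by blast
  then show ?thesis using assms unfolding basis_of_def by blast
qed

lemma basis_of_card_ge:
  assumes "basis_of A B" "J \<in> \<I>" "J \<subseteq> A"
  shows "card J \<le> card B"
proof (rule ccontr)
  assume "\<not> ?thesis"
  then obtain z where "z \<in> J - B" "insert z B \<in> \<I>"
    using augment[of B J] assms unfolding basis_of_def by force
  then show False using assms unfolding basis_of_def by blast
qed

text \<open>If \<open>x\<close> enlarged another basis \<open>B'\<close>, then
  \<open>insert x B'\<close> would be larger than \<open>B\<close>, and augmenting \<open>B\<close>
  from it could only add \<open>x\<close>.\<close>

lemma clI:
  assumes "basis_of A B" "x \<in> E" "x \<in> B \<or> insert x B \<notin> \<I>"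
  shows "x \<in> cl A"
proof -
  have "x \<in> B' \<or> insert x B' \<notin> \<I>" if B': "basis_of A B'" for B'
  proof (rule ccontr)
    assume neg: "\<not> ?thesis"
    have "card B \<le> card B'"
      using basis_of_card_ge[OF B', of B] assms(1) by (auto simp: basis_of_def)
    also have "\<dots> < card (insert x B')"
      using neg finite_indep B' by (auto simp: basis_of_def)
    finally show False
      using basis_of_augment[OF assms(1), of "insert x B'" x] neg B' assms(3)
      by (auto simp: basis_of_def)
  qed
  then show ?thesis using assms(2) by (auto simp: cl_def)
qed

lemma subset_cl: "A \<subseteq> E \<Longrightarrow> A \<subseteq> cl A"
  by (auto simp: cl_def basis_of_def)

text \<open>A basis \<open>I\<close> of \<open>A\<close> stays maximal in
  \<open>A \<union> B\<close> because \<open>B\<close> is spanned. If \<open>x\<close> enlarged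
  \<open>I\<close>, it would also enlarge the basis \<open>K\<close> of the union and, by heredity,
  the basis \<open>J\<close> of \<open>B\<close> inside \<open>K\<close>.\<close>

lemma cl_subset_cl:
  assumes "A \<subseteq> E" "B \<subseteq> cl A"
  shows "cl B \<subseteq> cl A"
proof
  fix x assume x: "x \<in> cl B"
  obtain I where I: "basis_of A I" by (rule basis_of_exists)
  have I': "basis_of (A \<union> B) I"
    using I assms(2) unfolding basis_of_def cl_def by blast
  obtain J where J: "basis_of B J" by (rule basis_of_exists)
  obtain K where K: "basis_of (A \<union> B) K" "J \<subseteq> K"
    using extend_to_basis[of J "A \<union> B"] J by (auto simp: basis_of_def)
  show "x \<in> cl A"
  proof (rule clI[OF I])
    show "x \<in> E" using x by (simp add: cl_def)
    show "x \<in> I \<or> insert x I \<notin> \<I>"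
    proof (rule ccontr)
      assume neg: "\<not> ?thesis"
      have "card K \<le> card I"
        using basis_of_card_ge[OF I', of K] K by (auto simp: basis_of_def)
      also have "\<dots> < card (insert x I)"
        using neg finite_indep I by (auto simp: basis_of_def)
      finally have "x \<notin> K \<and> insert x K \<in> \<I>"
        using basis_of_augment[OF K(1), of "insert x I" x] neg I by (auto simp: basis_of_def)
      then have "x \<notin> J \<and> insert x J \<in> \<I>"
        using K(2) hereditary[of "insert x K" "insert x J"] by blast
      then show False using x J by (auto simp: cl_def)
    qed
  qed
qed

lemma cl_mono: "A \<subseteq> B \<Longrightarrow> B \<subseteq> E \<Longrightarrow> cl A \<subseteq> cl B"
  using cl_subset_cl[of B A] subset_cl[of B] by blast

text \<open>An element of \<open>J\<close> that augments a basis of \<open>A\<close> would lie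
  outside \<open>cl A\<close>. This turns spanning into the counting bound for
  \<open>OPT\<close>.\<close>

lemma card_le_of_subset_cl:
  assumes "J \<in> \<I>" "J \<subseteq> cl A" "finite A"
  shows "card J \<le> card A"
proof -
  obtain B where B: "basis_of A B" by (rule basis_of_exists)
  have "card J \<le> card B"
  proof (rule ccontr)
    assume "\<not> ?thesis"
    then obtain z where "z \<in> J - B" "insert z B \<in> \<I>"
      using augment[of B J] assms B unfolding basis_of_def by force
    then show False using assms(2) B by (auto simp: cl_def)
  qed
  also have "\<dots> \<le> card A"
    using B assms(3) by (auto simp: basis_of_def intro: card_mono)
  finally show ?thesis .
qed

text \<open>The elements of an independent set \<open>S\<close> that can be swapped for \<open>x\<close> form, together with \<open>x\<close>,
  the fundamental circuit of \<open>x\<close>.\<close>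

lemma fundamental_circuit_dependent:
  assumes S: "S \<in> \<I>" "S \<union> {x} \<notin> \<I>"
    and T: "T = {y \<in> S. (S - {y}) \<union> {x} \<in> \<I>}"
  shows "insert x T \<notin> \<I>"
proof
  assume ind: "insert x T \<in> \<I>"
  \<comment> \<open>A basis \<open>K\<close> containing the supposedly independent
    \<open>insert x T\<close> has at least \<open>card S\<close> elements but omits some
    \<open>y\<close> of \<open>S\<close>, so it is \<open>S\<close> with \<open>y\<close> swapped
    for \<open>x\<close>. This puts \<open>y\<close> in \<open>T\<close>, hence in
    \<open>K\<close>.\<close>
  obtain K where K: "basis_of (insert x S) K" "insert x T \<subseteq> K"
    using extend_to_basis[OF ind, of "insert x S"] T by auto
  have "card S \<le> card K"
    using basis_of_card_ge[OF K(1), of S] S by auto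
  moreover have "K \<noteq> insert x S"
    using K S by (auto simp: basis_of_def)
  then obtain y where y: "y \<in> S" "y \<notin> K"
    using K unfolding basis_of_def by blast
  moreover have "K \<subseteq> insert x (S - {y})"
    using K y unfolding basis_of_def by blast
  moreover have "finite S" using S finite_indep by blast
  moreover have "card (insert x (S - {y})) \<le> card S"
  proof -
    have "card (insert x (S - {y})) \<le> Suc (card (S - {y}))"
      by (rule card_insert_le_m1) auto
    then show ?thesis using card_Suc_Diff1[OF \<open>finite S\<close> y(1)] by simp
  qed
  ultimately have "K = insert x (S - {y})"
    by (intro card_seteq) auto
  then have "y \<in> T" using K y T by (auto simp: basis_of_def)
  then show False using K y by auto
qed

lemma in_cl_swap_candidates:
  assumes "S \<in> \<I>" "S \<union> {x} \<notin> \<I>" "x \<in> E"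
    and T: "T = {y \<in> S. (S - {y}) \<union> {x} \<in> \<I>}"
  shows "x \<in> cl T"
proof (rule clI)
  show "basis_of T T"
    by (rule basis_of_indep, rule hereditary[OF assms(1)]) (use T in auto)
  show "x \<in> T \<or> insert x T \<notin> \<I>"
    using fundamental_circuit_dependent[OF assms(1,2) T] by blast
qed fact

text \<open>Without \<open>c\<close>, the circuit lies in \<open>(S - {c}) \<union> {x}\<close>, so
  it is independent and its own basis; adding \<open>c\<close> restores the dependent circuit. This
  lets \<open>x\<close> and the other candidates stand in for a removed element.\<close>

lemma swap_candidate_in_cl:
  assumes "S \<in> \<I>" "S \<union> {x} \<notin> \<I>"
    and T: "T = {y \<in> S. (S - {y}) \<union> {x} \<in> \<I>}" and c: "c \<in> T"
  shows "c \<in> cl (insert x (T - {c}))"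
proof (rule clI)
  show "basis_of (insert x (T - {c})) (insert x (T - {c}))"
    by (rule basis_of_indep, rule hereditary[of "(S - {c}) \<union> {x}"]) (use T c in auto)
  have "insert c (insert x (T - {c})) = insert x T" using c by auto
  then show "c \<in> insert x (T - {c}) \<or> insert c (insert x (T - {c})) \<notin> \<I>"
    using fundamental_circuit_dependent[OF assms(1,2) T] by auto
  show "c \<in> E" using c T assms(1) indep_subset_ground by auto
qed

end

section \<open>Incremental values of monotone submodular functions\<close>

locale monotone_submodular =
  fixes X :: "'a set" and f :: "'a set \<Rightarrow> real"
  assumes finite_domain: "finite X"
    and mono: "mono_on (Pow X) f"
    and submodular: "submodular_on X f"
begin

lemma f_mono: "A \<subseteq> B \<Longrightarrow> B \<subseteq> X \<Longrightarrow> f A \<le> f B"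
  using mono by (auto simp: mono_on_def)

lemma marginal_nonneg: "A \<subseteq> X \<Longrightarrow> x \<in> X \<Longrightarrow> 0 \<le> marginal f x A"
  using f_mono[of A "A \<union> {x}"] by (auto simp: marginal_def)

lemma marginal_antimono:
  assumes "A \<subseteq> B" "B \<subseteq> X" "x \<in> X"
  shows "marginal f x B \<le> marginal f x A"
\<comment> \<open>If \<open>x\<close> is in \<open>B\<close>, the left side is zero and monotonicity
  suffices; otherwise submodularity applies to \<open>A \<union> {x}\<close> and
  \<open>B\<close>.\<close>
proof (cases "x \<in> B")
  case True
  then have "B \<union> {x} = B" by auto
  then show ?thesis
    using marginal_nonneg[of A x] assms by (auto simp: marginal_def)
next
  case False
  then have "A \<subseteq> X" "(A \<union> {x}) \<union> B = B \<union> {x}" "(A \<union> {x}) \<inter> B = A" using assms by auto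
  then show ?thesis
    using submodular[unfolded submodular_on_def, rule_format, of "A \<union> {x}" B] assms
    by (simp add: marginal_def)
qed

lemma f_union_le:
  assumes "A \<subseteq> X" "B \<subseteq> X"
  shows "f (A \<union> B) \<le> f A + (\<Sum>x\<in>B. marginal f x A)"
proof -
  have "finite B" using assms finite_domain finite_subset by blast
  then show ?thesis using assms(2)
  proof (induction B)
    case (insert x B)
    have "marginal f x (A \<union> B) \<le> marginal f x A"
      using insert assms by (intro marginal_antimono) auto
    then show ?case using insert by (simp add: marginal_def)
  qed simp
qed

lemma incr_value_nonneg: "S \<subseteq> X \<Longrightarrow> e \<in> X \<Longrightarrow> 0 \<le> incr_value f prec e S"
  unfolding incr_value_def by (rule marginal_nonneg) auto

lemma incr_value_antimono:
  assumes "{t \<in> S. prec t e} \<subseteq> {t \<in> T. prec t e}" "T \<subseteq> X" "e \<in> X"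
  shows "incr_value f prec e T \<le> incr_value f prec e S"
  unfolding incr_value_def using assms by (intro marginal_antimono) auto

lemma finite_minimal_element:
  assumes "finite C" "C \<noteq> {}" "irreflp_on C prec" "transp_on C prec"
  shows "\<exists>c\<in>C. \<forall>t\<in>C. \<not> prec t c"
  using Finite_Set.bex_min_element[of C prec] assms
    asymp_on_iff_irreflp_on_if_transp_on[of C prec] by (metis irreflp_onD)

text \<open>The elements of \<open>C\<close> are put back earliest first. All predecessors in
  \<open>S\<close> of a minimal \<open>c\<close> lie in \<open>S - C\<close>, so its marginal there
  is at most its incremental value.\<close>

lemma f_diff_le_sum_incr_value:
  assumes "S \<subseteq> X" "irreflp_on S prec" "transp_on S prec" "C \<subseteq> S"
  shows "f S \<le> f (S - C) + (\<Sum>c\<in>C. incr_value f prec c S)"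
proof -
  have "finite C" using finite_subset[OF order.trans[OF assms(4,1)] finite_domain] .
  then show ?thesis using assms(4)
  proof (induction C rule: finite_psubset_induct)
    case (psubset C)
    show ?case
    proof (cases "C = {}")
      case False
      have "irreflp_on C prec" "transp_on C prec"
        using assms psubset.prems irreflp_on_subset transp_on_subset by metis+
      from finite_minimal_element[OF psubset.hyps False this]
      obtain c where c: "c \<in> C" "\<And>t. t \<in> C \<Longrightarrow> \<not> prec t c" by blast
      have "marginal f c (S - C) \<le> marginal f c {t \<in> S. prec t c}"
        using c psubset.prems assms by (intro marginal_antimono) auto
      moreover have "(S - C) \<union> {c} = S - (C - {c})" using c psubset.prems by auto
      ultimately have "f (S - (C - {c})) \<le> f (S - C) + incr_value f prec c S"
        by (simp add: marginal_def incr_value_def)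
      moreover have "f S \<le> f (S - (C - {c})) + (\<Sum>c\<in>C - {c}. incr_value f prec c S)"
        using psubset.IH[of "C - {c}"] c psubset.prems by auto
      ultimately show ?thesis
        using c psubset.hyps by (simp add: sum.remove)
    qed simp
  qed
qed

text \<open>The sum telescopes: removing the last element leaves the predecessors of all others
  unchanged.\<close>

lemma sum_incr_value:
  assumes "S \<subseteq> X" "irreflp_on S prec" "transp_on S prec" "totalp_on S prec"
  shows "(\<Sum>s\<in>S. incr_value f prec s S) = f S - f {}"
proof -
  have "finite S" using finite_subset[OF assms(1) finite_domain] .
  then show ?thesis using assms
  proof (induction S rule: finite_psubset_induct)
    case (psubset S)
    show ?case
    proof (cases "S = {}")
      case False
      have "\<exists>c\<in>S. \<forall>t\<in>S. \<not> prec c t"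
      proof (rule finite_minimal_element[OF psubset.hyps False])
        show "irreflp_on S (\<lambda>s t. prec t s)"
          using psubset.prems(2) by (simp add: irreflp_on_def)
        show "transp_on S (\<lambda>s t. prec t s)"
          using psubset.prems(3) unfolding transp_on_def by blast
      qed
      then obtain c where c: "c \<in> S" "\<And>t. t \<in> S \<Longrightarrow> \<not> prec c t" by blast
      have below: "{t \<in> S. prec t c} = S - {c}"
        using c psubset.prems(4) psubset.prems(2) by (auto simp: totalp_on_def irreflp_on_def)
      have "incr_value f prec s S = incr_value f prec s (S - {c})" if "s \<in> S - {c}" for s
      proof -
        have "{t \<in> S. prec t s} = {t \<in> S - {c}. prec t s}" using c that by auto
        then show ?thesis by (simp add: incr_value_def)
      qed
      then have "(\<Sum>s\<in>S - {c}. incr_value f prec s S) = f (S - {c}) - f {}"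
        using psubset.IH[of "S - {c}"] psubset.prems c
        by (auto intro: irreflp_on_subset transp_on_subset totalp_on_subset)
      moreover have "incr_value f prec c S = f S - f (S - {c})"
        using c below by (simp add: incr_value_def marginal_def insert_absorb)
      ultimately show ?thesis
        using c psubset.hyps by (simp add: sum.remove)
    qed simp
  qed
qed

end

section \<open>Comparison of sums through superlevel sets\<close>

lemma sum_le_of_card_superlevel_le:
  fixes w :: "'b \<Rightarrow> real" and v :: "'c \<Rightarrow> real"
  assumes "finite R" "finite U"
    and "\<And>x. x \<in> R \<Longrightarrow> 0 < w x" and "\<And>e. e \<in> U \<Longrightarrow> 0 \<le> v e"
    and "\<And>\<theta>. 0 < \<theta> \<Longrightarrow> card {x \<in> R. \<theta> \<le> w x} \<le> card {e \<in> U. \<theta> \<le> v e}"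
  shows "(\<Sum>x\<in>R. w x) \<le> (\<Sum>e\<in>U. v e)"
  using assms
proof (induction R arbitrary: U rule: finite_psubset_induct)
  case (psubset R)
  show ?case
  proof (cases "R = {}")
    case True
    then show ?thesis using psubset.prems by (auto intro: sum_nonneg)
  next
    case False
    \<comment> \<open>The heaviest \<open>x\<close> is paired with some \<open>e\<close> of value at
      least \<open>m\<close>. Deleting the pair lowers both counts by one for thresholds up to
      \<open>m\<close>, and beyond \<open>m\<close> nothing is left to count in
      \<open>R\<close>.\<close>
    define m where "m = Max (w ` R)"
    have m: "m \<in> w ` R" "\<And>x. x \<in> R \<Longrightarrow> w x \<le> m"
      using psubset.hyps False by (auto simp: m_def)
    then obtain x where x: "x \<in> R" "w x = m" by auto
    have "0 < card {y \<in> R. m \<le> w y}"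
      using x psubset.hyps by (auto simp: card_gt_0_iff)
    also have "\<dots> \<le> card {e \<in> U. m \<le> v e}"
      using psubset.prems(2,4) x by blast
    finally obtain e where e: "e \<in> U" "m \<le> v e"
      by (auto simp: card_gt_0_iff)
    have "(\<Sum>y\<in>R - {x}. w y) \<le> (\<Sum>u\<in>U - {e}. v u)"
    proof (rule psubset.IH)
      fix \<theta> :: real assume \<theta>: "0 < \<theta>"
      show "card {y \<in> R - {x}. \<theta> \<le> w y} \<le> card {u \<in> U - {e}. \<theta> \<le> v u}"
      proof (cases "\<theta> \<le> m")
        case True
        have "{y \<in> R - {x}. \<theta> \<le> w y} = {y \<in> R. \<theta> \<le> w y} - {x}"
          "{u \<in> U - {e}. \<theta> \<le> v u} = {u \<in> U. \<theta> \<le> v u} - {e}" by auto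
        then show ?thesis
          using psubset.prems(4)[OF \<theta>] True x e by (simp add: card_Diff_singleton diff_le_mono)
      next
        case False
        then have "{y \<in> R - {x}. \<theta> \<le> w y} = {}" using m by fastforce
        then show ?thesis by (simp only: card.empty)
      qed
    qed (use x psubset.prems in auto)
    then show ?thesis
      using x e psubset.hyps psubset.prems(1) by (simp add: sum.remove)
  qed
qed

section \<open>Pretend orders\<close>

lemma arrives_before_trans:
  assumes "distinct xs" "arrives_before xs a b" "arrives_before xs b c"
  shows "arrives_before xs a c"
  using assms unfolding arrives_before_def
  by (metis nth_eq_iff_index_eq order.strict_trans)

lemma arrives_before_irrefl: "distinct xs \<Longrightarrow> \<not> arrives_before xs a a"
  unfolding arrives_before_def by (metis nth_eq_iff_index_eq order.strict_trans order_less_irrefl)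

lemma arrives_before_total:
  "a \<in> set xs \<Longrightarrow> b \<in> set xs \<Longrightarrow> a \<noteq> b \<Longrightarrow> arrives_before xs a b \<or> arrives_before xs b a"
  unfolding arrives_before_def by (metis in_set_conv_nth linorder_neqE_nat)

lemma arrives_before_append:
  "a \<in> set ys \<Longrightarrow> arrives_before (ys @ x # zs) a x"
  unfolding arrives_before_def in_set_conv_nth
  by (metis length_append less_add_same_cancel1 length_greater_0_conv list.distinct(1) nth_append nth_append_length)

definition strict_linear_on :: "'a set \<Rightarrow> ('a \<Rightarrow> 'a \<Rightarrow> bool) \<Rightarrow> bool" where
  "strict_linear_on A prec \<longleftrightarrow> irreflp_on A prec \<and> transp_on A prec \<and> totalp_on A prec"

lemma strict_linear_on_subset:
  "strict_linear_on B prec \<Longrightarrow> A \<subseteq> B \<Longrightarrow> strict_linear_on A prec"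
  unfolding strict_linear_on_def
  by (auto intro: irreflp_on_subset transp_on_subset totalp_on_subset)

lemma strict_linear_on_pretend_step:
  assumes "strict_linear_on A prev" "distinct xs"
  shows "strict_linear_on (set xs) (pretend_step prev A xs)"
  unfolding strict_linear_on_def
proof (intro conjI)
  show "irreflp_on (set xs) (pretend_step prev A xs)"
    using assms arrives_before_irrefl[OF assms(2)]
    unfolding irreflp_on_def pretend_step_def strict_linear_on_def by blast
  show "transp_on (set xs) (pretend_step prev A xs)"
  proof (rule transp_onI)
    fix a b c
    assume "pretend_step prev A xs a b" "pretend_step prev A xs b c"
    then show "pretend_step prev A xs a c"
      using assms arrives_before_trans[OF assms(2), of a b c]
      unfolding pretend_step_def strict_linear_on_def transp_on_def by blast
  qed
  show "totalp_on (set xs) (pretend_step prev A xs)"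
  proof (rule totalp_onI)
    fix a b assume "a \<in> set xs" "b \<in> set xs" "a \<noteq> b"
    then show "pretend_step prev A xs a b \<or> pretend_step prev A xs b a"
      using assms(1) arrives_before_total[of a xs b]
      unfolding pretend_step_def strict_linear_on_def totalp_on_def by blast
  qed
qed


section \<open>One pass of local search\<close>

text \<open>Abstracts one pass from the pretend order: \<open>new_last\<close> ties order and stream
  together by placing a fresh element after everything in \<open>Init\<close> or seen earlier.
  \<open>OPT\<close> stands for an arbitrary feasible set.\<close>

locale local_search_pass =
  matchoid p X L E \<I> + monotone_submodular X f
  for p :: nat and X :: "'a set" and L :: "'l set" and E :: "'l \<Rightarrow> 'a set"
    and \<I> :: "'l \<Rightarrow> 'a set set" and f :: "'a set \<Rightarrow> real" +
  fixes prec :: "'a \<Rightarrow> 'a \<Rightarrow> bool" and \<alpha> \<beta> :: real and Init :: "'a set" and xs :: "'a list"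
    and OPT :: "'a set"
  assumes linear: "strict_linear_on X prec"
    and distinct_xs: "distinct xs" and set_xs: "set xs = X"
    and new_last: "xs = ys @ x # zs \<Longrightarrow> x \<notin> Init \<Longrightarrow> s \<in> Init \<union> set ys \<Longrightarrow> prec s x"
    and feasible_Init: "feasible X L E \<I> Init"
    and feasible_OPT: "feasible X L E \<I> OPT"
    and alpha_nonneg: "0 \<le> \<alpha>" and beta_pos: "0 < \<beta>"
    and f_empty_nonneg: "0 \<le> f {}"
begin

abbreviation (input) \<nu> :: "'a \<Rightarrow> 'a set \<Rightarrow> real" where "\<nu> \<equiv> incr_value f prec"
abbreviation (input) K :: "'a \<Rightarrow> 'a set \<Rightarrow> 'l set" where "K \<equiv> conflicts L E \<I>"

text \<open>Exposes the choice function hidden in \<open>exchange\<close>: the proof must know on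
  behalf of which matroids an element is removed.\<close>

definition exchange_map :: "'a \<Rightarrow> 'a set \<Rightarrow> ('l \<Rightarrow> 'a) \<Rightarrow> bool" where
  "exchange_map x S c \<longleftrightarrow>
     (\<forall>l\<in>K x S. is_arg_min (\<lambda>y. \<nu> y S) (\<lambda>y. y \<in> swap_candidates E \<I> x S l) (c l))"

lemma exchange_iff: "exchange f prec L E \<I> x S C \<longleftrightarrow> (\<exists>c. exchange_map x S c \<and> C = c ` K x S)"
  by (simp add: exchange_def exchange_map_def)

lemma order_facts:
  assumes "S \<subseteq> X"
  shows "irreflp_on S prec" "transp_on S prec" "totalp_on S prec"
  using strict_linear_on_subset[OF linear assms] by (auto simp: strict_linear_on_def)

lemma feasible_subset: "feasible X L E \<I> S \<Longrightarrow> S \<subseteq> X"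
  by (simp add: feasible_def)

lemma finite_subset_X: "S \<subseteq> X \<Longrightarrow> finite S"
  using finite_X finite_subset by blast

lemma finite_conflicts: "x \<in> X \<Longrightarrow> finite (K x S)"
  using multiplicity[of x] by (auto simp: conflicts_def elim: finite_subset[rotated])

lemma exchange_map_exists:
  assumes "feasible X L E \<I> S" "x \<in> OPT"
  shows "\<exists>c. exchange_map x S c"
proof -
  have "\<exists>y. is_arg_min (\<lambda>y. \<nu> y S) (\<lambda>y. y \<in> swap_candidates E \<I> x S l) y"
    if l: "l \<in> K x S" for l
  proof -
    have lL: "l \<in> L" and xE: "x \<in> E l" and dep: "(S \<inter> E l) \<union> {x} \<notin> \<I> l"
      using l by (auto simp: conflicts_def)
    interpret M: matroid "E l" "\<I> l" using matroid[OF lL] .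
    have S: "S \<inter> E l \<in> \<I> l" using assms(1) lL by (auto simp: feasible_def)
    have "{x} \<in> \<I> l"
      using feasible_OPT assms(2) lL xE M.hereditary[of "OPT \<inter> E l" "{x}"]
      by (auto simp: feasible_def)
    \<comment> \<open>Without swap candidates the fundamental circuit would be \<open>{x}\<close>
      itself, contradicting the independence of \<open>{x}\<close>.\<close>
    then have "swap_candidates E \<I> x S l \<noteq> {}"
      using M.fundamental_circuit_dependent[OF S dep refl] unfolding swap_candidates_def by metis
    moreover have "finite (swap_candidates E \<I> x S l)"
      using finite_subset_X[OF feasible_subset[OF assms(1)]]
      by (auto simp: swap_candidates_def)
    ultimately show ?thesis
      using ex_is_arg_min_if_finite by blast
  qed
  then show ?thesis unfolding exchange_map_def by metis
qed

text \<open>An element that has left the solution keeps, in \<open>\<chi>\<close>, its incremental value at the time of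
  removal.\<close>

definition current_value :: "'a set \<Rightarrow> ('a \<Rightarrow> real) \<Rightarrow> 'a \<Rightarrow> real" where
  "current_value S \<chi> e = (if e \<in> S then \<nu> e S else \<chi> e)"

text \<open>\<open>P\<close> is the set of elements seen so far, \<open>A\<close> consists of \<open>Init\<close> and all elements accepted so
  far, \<open>U l\<close> of those elements of \<open>A \<inter> E l\<close> that have not been removed on behalf of the matroid \<open>l\<close>,
  and \<open>w x l\<close> is the value of the element with which \<open>x\<close> was compared in \<open>l\<close> when it was rejected
  (0 if there was no conflict).\<close>

definition invariant ::
    "'a set \<Rightarrow> 'a set \<Rightarrow> 'a set \<Rightarrow> ('a \<Rightarrow> real) \<Rightarrow> ('l \<Rightarrow> 'a set) \<Rightarrow> ('a \<Rightarrow> 'l \<Rightarrow> real) \<Rightarrow> bool" where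
  "invariant P S A \<chi> U w \<longleftrightarrow>
     feasible X L E \<I> S \<and> S \<subseteq> A \<and> Init \<subseteq> A \<and> A \<subseteq> Init \<union> P \<and> P \<subseteq> X \<and>
     f A \<le> f S + sum \<chi> (A - S) \<and>
     \<beta> * sum \<chi> (A - S) \<le> f S - f Init \<and>
     (\<forall>e\<in>A - S. 0 \<le> \<chi> e \<and> (\<exists>l\<in>L. e \<in> E l - U l)) \<and>
     (\<forall>l\<in>L. S \<inter> E l \<subseteq> U l \<and> U l \<subseteq> A \<inter> E l) \<and>
     (\<forall>x l. 0 \<le> w x l) \<and>
     (\<forall>x\<in>OPT \<inter> P - A. marginal f x A \<le> \<alpha> + (1 + \<beta>) * (\<Sum>l | l \<in> L \<and> x \<in> E l. w x l)) \<and>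
     (\<forall>x\<in>OPT \<inter> P - A. \<forall>l\<in>L. x \<in> E l \<longrightarrow> 0 < w x l \<longrightarrow>
        x \<in> matroid.cl (E l) (\<I> l) {e \<in> U l. w x l \<le> current_value S \<chi> e})"

section \<open>Preservation of the invariant during a pass\<close>

lemma invariant_init: "invariant {} Init Init (\<lambda>_. 0) (\<lambda>l. Init \<inter> E l) (\<lambda>_ _. 0)"
  using feasible_Init by (auto simp: invariant_def)

lemma invariant_skip:
  assumes "invariant P S A \<chi> U w" "x \<in> X" "x \<in> A \<or> x \<notin> OPT"
  shows "invariant (insert x P) S A \<chi> U w"
proof -
  have "OPT \<inter> insert x P - A = OPT \<inter> P - A" using assms(3) by auto
  then show ?thesis using assms(1,2) unfolding invariant_def by auto
qed

lemma exchange_mapD: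
  assumes "exchange_map x S c" "l \<in> K x S"
  shows "c l \<in> swap_candidates E \<I> x S l" "c l \<in> S" "c l \<in> E l"
    and "y \<in> swap_candidates E \<I> x S l \<Longrightarrow> \<nu> (c l) S \<le> \<nu> y S"
proof -
  have *: "is_arg_min (\<lambda>y. \<nu> y S) (\<lambda>y. y \<in> swap_candidates E \<I> x S l) (c l)"
    using assms by (auto simp: exchange_map_def)
  then show "c l \<in> swap_candidates E \<I> x S l" by (simp add: is_arg_min_def)
  then show "c l \<in> S" "c l \<in> E l" by (auto simp: swap_candidates_def)
  show "\<nu> (c l) S \<le> \<nu> y S" if "y \<in> swap_candidates E \<I> x S l"
    using * that by (simp add: is_arg_min_linorder)
qed

text \<open>For a conflicting matroid the recorded weight is the minimum value among the swap
  candidates, which span \<open>x\<close> and lie in \<open>U l\<close>. The rejection test was made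
  against \<open>S\<close>, and the marginal can only drop when \<open>S\<close> grows to
  \<open>A\<close>.\<close>

lemma invariant_reject:
  assumes inv: "invariant P S A \<chi> U w" and x: "x \<in> X" "x \<notin> P" "x \<notin> A"
    and c: "exchange_map x S c"
    and reject: "marginal f x S < \<alpha> + (1 + \<beta>) * (\<Sum>e\<in>c ` K x S. \<nu> e S)"
  shows "invariant (insert x P) S A \<chi> U
           (w(x := \<lambda>l. if l \<in> K x S then \<nu> (c l) S else 0))"
    (is "invariant _ _ _ _ _ ?w")
proof -
  have feas: "feasible X L E \<I> S" and SA: "S \<subseteq> A" and AX: "A \<subseteq> X"
    using inv feasible_Init by (auto simp: invariant_def feasible_def)
  have SX: "S \<subseteq> X" using SA AX by auto
  have nonneg: "0 \<le> \<nu> (c l) S" if "l \<in> K x S" for l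
    using exchange_mapD(2)[OF c that] SX by (auto intro: incr_value_nonneg)
  \<comment> \<open>The image counts an element chosen by several matroids once; values being
    nonnegative, summing over the matroids gives at least as much.\<close>
  have "(\<Sum>e\<in>c ` K x S. \<nu> e S) \<le> (\<Sum>l\<in>K x S. \<nu> (c l) S)"
    using sum_image_le[OF finite_conflicts[OF x(1)], where g = "\<lambda>e. \<nu> e S" and f = c] nonneg by (simp add: o_def)
  also have "\<dots> = (\<Sum>l\<in>K x S. ?w x l)" by (intro sum.cong) auto
  also have "\<dots> = (\<Sum>l | l \<in> L \<and> x \<in> E l. ?w x l)"
    using multiplicity[OF x(1)] by (intro sum.mono_neutral_left) (auto simp: conflicts_def)
  finally have "(\<Sum>e\<in>c ` K x S. \<nu> e S) \<le> (\<Sum>l | l \<in> L \<and> x \<in> E l. ?w x l)" .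
  then have "\<alpha> + (1 + \<beta>) * (\<Sum>e\<in>c ` K x S. \<nu> e S)
      \<le> \<alpha> + (1 + \<beta>) * (\<Sum>l | l \<in> L \<and> x \<in> E l. ?w x l)"
    using beta_pos by (intro add_left_mono mult_left_mono) auto
  then have marg: "marginal f x A \<le> \<alpha> + (1 + \<beta>) * (\<Sum>l | l \<in> L \<and> x \<in> E l. ?w x l)"
    using reject marginal_antimono[OF SA AX x(1)] by linarith
  have span: "x \<in> matroid.cl (E l) (\<I> l) {e \<in> U l. ?w x l \<le> current_value S \<chi> e}"
    if l: "l \<in> L" "x \<in> E l" "0 < ?w x l" for l
  proof -
    interpret M: matroid "E l" "\<I> l" using matroid[OF l(1)] .
    have lK: "l \<in> K x S" using l(3) by (auto split: if_splits)
    then have dep: "(S \<inter> E l) \<union> {x} \<notin> \<I> l" by (simp add: conflicts_def)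
    have S: "S \<inter> E l \<in> \<I> l" using feas l(1) by (auto simp: feasible_def)
    have U: "S \<inter> E l \<subseteq> U l" "U l \<subseteq> E l" using inv l(1) by (auto simp: invariant_def)
    have "x \<in> M.cl (swap_candidates E \<I> x S l)"
      unfolding swap_candidates_def using M.in_cl_swap_candidates[OF S dep l(2) refl] .
    moreover have "swap_candidates E \<I> x S l \<subseteq> {e \<in> U l. ?w x l \<le> current_value S \<chi> e}"
    proof
      fix e assume e: "e \<in> swap_candidates E \<I> x S l"
      then have "e \<in> S \<inter> E l" by (auto simp: swap_candidates_def)
      then show "e \<in> {e \<in> U l. ?w x l \<le> current_value S \<chi> e}"
        using U exchange_mapD(4)[OF c lK e] lK by (auto simp: current_value_def)
    qed
    ultimately show ?thesis
      using M.cl_mono[of _ "{e \<in> U l. ?w x l \<le> current_value S \<chi> e}"] U by blast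
  qed
  have w_nonneg: "0 \<le> ?w y l" for y l
    using inv nonneg by (auto simp: invariant_def)
  have split: "y = x \<or> y \<in> OPT \<inter> P - A" if "y \<in> OPT \<inter> insert x P - A" for y using that by auto
  have old: "?w y = w y" if "y \<in> OPT \<inter> P - A" for y using that x by auto
  show ?thesis
    unfolding invariant_def
  proof (intro conjI)
    show "\<forall>y\<in>OPT \<inter> insert x P - A.
        marginal f y A \<le> \<alpha> + (1 + \<beta>) * (\<Sum>l | l \<in> L \<and> y \<in> E l. ?w y l)"
    proof
      fix y assume "y \<in> OPT \<inter> insert x P - A"
      then consider "y = x" | "y \<in> OPT \<inter> P - A" using split by blast
      then show "marginal f y A \<le> \<alpha> + (1 + \<beta>) * (\<Sum>l | l \<in> L \<and> y \<in> E l. ?w y l)"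
      proof cases
        case 2
        show ?thesis unfolding old[OF 2] using inv 2 unfolding invariant_def by blast
      qed (use marg in blast)
    qed
    show "\<forall>y\<in>OPT \<inter> insert x P - A. \<forall>l\<in>L. y \<in> E l \<longrightarrow> 0 < ?w y l \<longrightarrow>
        y \<in> matroid.cl (E l) (\<I> l) {e \<in> U l. ?w y l \<le> current_value S \<chi> e}"
    proof (intro ballI impI)
      fix y l assume "y \<in> OPT \<inter> insert x P - A" and l: "l \<in> L" "y \<in> E l" "0 < ?w y l"
      then consider "y = x" | "y \<in> OPT \<inter> P - A" using split by blast
      then show "y \<in> matroid.cl (E l) (\<I> l) {e \<in> U l. ?w y l \<le> current_value S \<chi> e}"
      proof cases
        case 1
        then show ?thesis using span[of l] l by blast
      next
        case 2
        show ?thesis using l inv 2 unfolding old[OF 2] invariant_def by blast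
      qed
    qed
    show "\<forall>y l. 0 \<le> ?w y l" using w_nonneg by blast
  qed (use inv x(1) in \<open>auto simp: invariant_def\<close>)
qed

text \<open>Spanning has to survive a swap. In each conflicting matroid the chosen element leaves
  \<open>U l\<close>, and \<open>x\<close> together with the remaining swap candidates takes its
  place at every threshold that it met.\<close>

lemma invariant_accept:
  assumes inv: "invariant P S A \<chi> U w" and x: "x \<in> X" "x \<notin> P" "x \<notin> A"
    and last: "\<And>s. s \<in> A \<Longrightarrow> prec s x"
    and c: "exchange_map x S c"
    and C: "C = c ` K x S"
    and accept: "marginal f x S \<ge> \<alpha> + (1 + \<beta>) * (\<Sum>e\<in>C. \<nu> e S)"
  shows "invariant (insert x P) (S - C \<union> {x}) (insert x A)
           (\<lambda>e. if e \<in> C then \<nu> e S else \<chi> e)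
           (\<lambda>l. (U l - (if l \<in> K x S then {c l} else {})) \<union> ({x} \<inter> E l)) w"
    (is "invariant _ ?S _ ?\<chi> ?U _")
proof -
  have feas: "feasible X L E \<I> S" and SA: "S \<subseteq> A" and AX: "A \<subseteq> X"
    using inv feasible_Init by (auto simp: invariant_def feasible_def)
  have SX: "S \<subseteq> X" and xS: "x \<notin> S" using SA AX x by auto
  have CS: "C \<subseteq> S" using C exchange_mapD(2)[OF c] by auto
  have fin: "finite A" "finite S" "finite C"
    using finite_subset_X AX SX order.trans[OF CS SX] by auto
  have nu_nonneg: "0 \<le> \<nu> e S" if "e \<in> C" for e
    using that CS SX by (intro incr_value_nonneg) auto
  have not_before: "\<not> prec x s" if "s \<in> A" for s
    using last[OF that] order_facts(1,2)[of X] x(1) that AX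
    by (metis irreflp_onD subset_iff transp_onD order_refl)

  have feas': "feasible X L E \<I> ?S"
    unfolding feasible_def
  proof (intro conjI ballI)
    show "?S \<subseteq> X" using SX x by auto
    fix l assume l: "l \<in> L"
    interpret M: matroid "E l" "\<I> l" using matroid[OF l] .
    have S: "S \<inter> E l \<in> \<I> l" using feas l by (auto simp: feasible_def)
    consider "x \<notin> E l" | "l \<in> K x S" | "x \<in> E l" "l \<notin> K x S" by blast
    then show "?S \<inter> E l \<in> \<I> l"
    proof cases
      case 1
      then show ?thesis by (intro M.hereditary[OF S]) auto
    next
      case 2
      then have "((S \<inter> E l) - {c l}) \<union> {x} \<in> \<I> l"
        using exchange_mapD(1)[OF c] by (auto simp: swap_candidates_def)
      then show ?thesis by (rule M.hereditary) (use 2 C in auto)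
    next
      case 3
      then have "(S \<inter> E l) \<union> {x} \<in> \<I> l" using l by (auto simp: conflicts_def)
      then show ?thesis by (rule M.hereditary) auto
    qed
  qed

  have diff: "insert x A - ?S = (A - S) \<union> C" using CS SA x by auto
  have chi_sum: "sum ?\<chi> (insert x A - ?S) = sum \<chi> (A - S) + (\<Sum>e\<in>C. \<nu> e S)"
  proof -
    have "sum ?\<chi> ((A - S) \<union> C) = sum ?\<chi> (A - S) + sum ?\<chi> C"
      using CS fin by (intro sum.union_disjoint) auto
    moreover have "sum ?\<chi> (A - S) = sum \<chi> (A - S)" using CS by (intro sum.cong) auto
    ultimately show ?thesis unfolding diff by simp
  qed
  \<comment> \<open>Removing \<open>C\<close> loses at most its incremental values, and
    \<open>x\<close> gains at least as much over \<open>S - C\<close> as over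
    \<open>S\<close>.\<close>
  have gain: "f S + marginal f x S \<le> f ?S + (\<Sum>e\<in>C. \<nu> e S)"
  proof -
    have "marginal f x S \<le> marginal f x (S - C)"
      using SX x by (intro marginal_antimono) auto
    moreover have "f S \<le> f (S - C) + (\<Sum>e\<in>C. \<nu> e S)"
      using f_diff_le_sum_incr_value[OF SX order_facts(1,2)[OF SX] CS] .
    ultimately show ?thesis by (simp add: marginal_def)
  qed
  have fA: "f (insert x A) \<le> f A + marginal f x S"
    using marginal_antimono[OF SA AX x(1)] by (simp add: marginal_def)
  have cover: "f (insert x A) \<le> f ?S + sum ?\<chi> (insert x A - ?S)"
    using inv gain fA unfolding chi_sum by (auto simp: invariant_def)
  \<comment> \<open>Once the loss of \<open>C\<close> is paid for, the acceptance test leaves a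
    surplus of at least \<open>\<beta>\<close> times the value just frozen.\<close>
  have "\<beta> * sum \<chi> (A - S) \<le> f S - f Init" using inv by (simp add: invariant_def)
  then have growth: "\<beta> * sum ?\<chi> (insert x A - ?S) \<le> f ?S - f Init"
    using gain accept alpha_nonneg unfolding chi_sum by (simp add: algebra_simps)

  \<comment> \<open>As \<open>x\<close> is last, its predecessors in the new solution are all of
    \<open>S - C\<close>. The acceptance test makes its value dominate the whole removed sum, hence
    each removed element.\<close>
  have value_x: "current_value ?S ?\<chi> x \<ge> (\<Sum>e\<in>C. \<nu> e S)"
  proof -
    have "{t \<in> ?S. prec t x} = S - C"
      using last SA order_facts(1)[of X] x(1) xS by (auto simp: irreflp_on_def)
    then have "current_value ?S ?\<chi> x = marginal f x (S - C)"
      by (simp add: current_value_def incr_value_def)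
    also have "\<dots> \<ge> marginal f x S" using SX x by (intro marginal_antimono) auto
    finally have "marginal f x S \<le> current_value ?S ?\<chi> x" .
    moreover have "0 \<le> \<beta> * (\<Sum>e\<in>C. \<nu> e S)"
      using beta_pos nu_nonneg by (intro mult_nonneg_nonneg sum_nonneg) auto
    ultimately show ?thesis
      using accept alpha_nonneg by (simp add: algebra_simps)
  qed
  \<comment> \<open>Since \<open>x\<close> precedes no element of \<open>A\<close>, the swap only
    takes predecessors away; an element of \<open>C\<close> keeps the value it had in
    \<open>S\<close>.\<close>
  have value_mono: "current_value S \<chi> e \<le> current_value ?S ?\<chi> e" if "e \<in> A" for e
  proof -
    have "\<nu> e S \<le> \<nu> e ?S"
      using not_before that AX SX by (intro incr_value_antimono) auto
    then show ?thesis using that x CS by (auto simp: current_value_def)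
  qed

  have removed: "0 \<le> ?\<chi> e \<and> (\<exists>l\<in>L. e \<in> E l - ?U l)" if "e \<in> insert x A - ?S" for e
  proof (cases "e \<in> C")
    case True
    then obtain l where l: "l \<in> K x S" "e = c l" using C by auto
    have "e \<noteq> x" "e \<in> E l" "l \<in> L"
      using True CS xS l exchange_mapD(3)[OF c l(1)] by (auto simp: conflicts_def)
    then show ?thesis using True nu_nonneg l by auto
  next
    case False
    then have "e \<in> A - S" "e \<noteq> x" using that diff x by auto
    then show ?thesis using inv False by (auto simp: invariant_def)
  qed

  have U: "?S \<inter> E l \<subseteq> ?U l" "?U l \<subseteq> insert x A \<inter> E l" if "l \<in> L" for l
  proof -
    have "S \<inter> E l \<subseteq> U l" "U l \<subseteq> A \<inter> E l" using inv that by (auto simp: invariant_def)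
    then show "?S \<inter> E l \<subseteq> ?U l" "?U l \<subseteq> insert x A \<inter> E l" using C by auto
  qed

  have span: "y \<in> matroid.cl (E l) (\<I> l) {e \<in> ?U l. w y l \<le> current_value ?S ?\<chi> e}"
    if y: "y \<in> OPT \<inter> P - A" and l: "l \<in> L" "y \<in> E l" "0 < w y l" for y l
  proof -
    interpret M: matroid "E l" "\<I> l" using matroid[OF l(1)] .
    let ?V = "{e \<in> U l. w y l \<le> current_value S \<chi> e}"
    let ?V' = "{e \<in> ?U l. w y l \<le> current_value ?S ?\<chi> e}"
    have UE: "S \<inter> E l \<subseteq> U l" "U l \<subseteq> A \<inter> E l" using inv l(1) by (auto simp: invariant_def)
    have V'E: "?V' \<subseteq> E l" using U(2)[OF l(1)] by blast
    have "y \<in> M.cl ?V" using inv y l by (auto simp: invariant_def)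
    moreover have "?V \<subseteq> M.cl ?V'"
    proof
      fix e assume e: "e \<in> ?V"
      show "e \<in> M.cl ?V'"
      proof (cases "l \<in> K x S \<and> e = c l")
        \<comment> \<open>This includes elements of \<open>C\<close> removed only for other
          matroids: they remain in \<open>U l\<close> with frozen value.\<close>
        case False
        then have "e \<in> ?V'" using e UE value_mono[of e] by auto
        then show ?thesis using M.subset_cl[OF V'E] by blast
      next
        case True
        then have lK: "l \<in> K x S" and ec: "e = c l" by auto
        have S: "S \<inter> E l \<in> \<I> l" using feas l(1) by (auto simp: feasible_def)
        have xE: "x \<in> E l" and dep: "(S \<inter> E l) \<union> {x} \<notin> \<I> l"
          using lK by (auto simp: conflicts_def)
        let ?T = "swap_candidates E \<I> x S l"
        have eT: "e \<in> ?T" and eS: "e \<in> S" using exchange_mapD(1,2)[OF c lK] ec by auto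
        have "\<nu> e S \<le> (\<Sum>e\<in>C. \<nu> e S)"
          using lK ec C fin nu_nonneg by (intro member_le_sum) auto
        then have "x \<in> ?V'"
          using e eS value_x xE by (auto simp: current_value_def)
        moreover have "z \<in> ?V'" if z: "z \<in> ?T - {e}" for z
        proof -
          have zS: "z \<in> S" "z \<in> U l" using z UE by (auto simp: swap_candidates_def)
          have "\<nu> e S \<le> \<nu> z S" using exchange_mapD(4)[OF c lK, of z] z ec by auto
          then have "w y l \<le> current_value S \<chi> z"
            using e eS zS by (auto simp: current_value_def)
          then show ?thesis using value_mono[of z] zS SA z ec by auto
        qed
        ultimately have "M.cl (insert x (?T - {e})) \<subseteq> M.cl ?V'"
          by (intro M.cl_mono V'E) blast
        moreover have "e \<in> M.cl (insert x (?T - {e}))"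
          using M.swap_candidate_in_cl[OF S dep refl] eT unfolding swap_candidates_def by blast
        ultimately show ?thesis by blast
      qed
    qed
    ultimately show ?thesis using M.cl_subset_cl[OF V'E] by blast
  qed

  have marg: "marginal f y (insert x A) \<le> \<alpha> + (1 + \<beta>) * (\<Sum>l | l \<in> L \<and> y \<in> E l. w y l)"
    if y: "y \<in> OPT \<inter> P - A" for y
  proof -
    have "marginal f y (insert x A) \<le> marginal f y A"
      using AX x y feasible_subset[OF feasible_OPT] by (intro marginal_antimono) auto
    also have "\<dots> \<le> \<alpha> + (1 + \<beta>) * (\<Sum>l | l \<in> L \<and> y \<in> E l. w y l)"
      using inv y unfolding invariant_def by blast
    finally show ?thesis .
  qed

  \<comment> \<open>The element \<open>x\<close> now belongs to the accepted set, so it adds no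
    obligation even if it lies in \<open>OPT\<close>.\<close>
  have OPT': "OPT \<inter> insert x P - insert x A = OPT \<inter> P - A" using x by auto
  show ?thesis
    unfolding invariant_def OPT'
  proof (intro conjI)
    show "?S \<subseteq> insert x A" "Init \<subseteq> insert x A" "insert x A \<subseteq> Init \<union> insert x P"
      "insert x P \<subseteq> X" "\<forall>x l. 0 \<le> w x l"
      using inv x unfolding invariant_def by blast+
  qed (intro feas' cover growth ballI impI conjI removed U marg span; assumption)+
qed

lemma invariant_step:
  assumes inv: "invariant P S A \<chi> U w"
    and step: "local_search_step f prec L E \<I> \<alpha> \<beta> Init x S S'"
    and x: "x \<in> X" "x \<notin> P" and last: "\<And>s. x \<notin> Init \<Longrightarrow> s \<in> Init \<union> P \<Longrightarrow> prec s x"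
  shows "\<exists>A \<chi> U w. invariant (insert x P) S' A \<chi> U w"
proof (cases "x \<in> Init")
  case True
  then have "S' = S" using step by (auto simp: local_search_step_def)
  moreover have "x \<in> A" using True inv unfolding invariant_def by blast
  ultimately show ?thesis using invariant_skip[OF inv x(1)] by blast
next
  case False
  have A: "Init \<subseteq> A" "A \<subseteq> Init \<union> P" and feas: "feasible X L E \<I> S"
    using inv by (auto simp: invariant_def)
  then have xA: "x \<notin> A" using False x by auto
  show ?thesis
  proof (cases "\<exists>C. exchange f prec L E \<I> x S C")
    case True
    then obtain c where c: "exchange_map x S c"
      and S': "S' = (if marginal f x S \<ge> \<alpha> + (1 + \<beta>) * (\<Sum>e\<in>c ` K x S. \<nu> e S)
                     then (S - c ` K x S) \<union> {x} else S)"
      using step False unfolding local_search_step_def exchange_iff by auto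
    have last': "prec s x" if "s \<in> A" for s using last[OF False] that A by blast
    show ?thesis
    proof (cases "marginal f x S \<ge> \<alpha> + (1 + \<beta>) * (\<Sum>e\<in>c ` K x S. \<nu> e S)")
      case True
      then show ?thesis
        using invariant_accept[OF inv x xA last' c refl True] S' by auto
    next
      case False
      then show ?thesis
        using invariant_reject[OF inv x xA c] S' by auto
    qed
  next
    case no: False
    \<comment> \<open>Every element of \<open>OPT\<close> admits an exchange, being a loop in no
      matroid.\<close>
    then have "x \<notin> OPT" using exchange_map_exists[OF feas] exchange_iff by blast
    moreover have "S' = S" using step False no by (auto simp: local_search_step_def)
    ultimately show ?thesis using invariant_skip[OF inv x(1)] by blast
  qed
qed

lemma invariant_run:
  assumes "local_search_run f prec L E \<I> \<alpha> \<beta> Init zs S S'"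
    and "invariant (set ys) S A \<chi> U w" and "xs = ys @ zs"
  shows "\<exists>A \<chi> U w. invariant X S' A \<chi> U w"
  using assms
proof (induction zs arbitrary: ys S A \<chi> U w)
  case Nil
  then show ?case using set_xs by auto
next
  case (Cons x zs)
  then obtain S'' where step: "local_search_step f prec L E \<I> \<alpha> \<beta> Init x S S''"
    and run: "local_search_run f prec L E \<I> \<alpha> \<beta> Init zs S'' S'" by auto
  have "x \<in> X" "x \<notin> set ys" using Cons.prems(3) set_xs distinct_xs by auto
  from invariant_step[OF Cons.prems(2) step this] new_last[OF Cons.prems(3)]
  obtain A \<chi> U w where "invariant (insert x (set ys)) S'' A \<chi> U w" by blast
  then show ?case using Cons.IH[OF run, of "ys @ [x]"] Cons.prems(3) by auto
qed

lemma invariant_final: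
  assumes "streaming_local_search f prec L E \<I> \<alpha> \<beta> Init xs S"
  obtains A \<chi> U w where "invariant X S A \<chi> U w"
  using invariant_run[of xs Init S "[]", simplified, OF _ invariant_init] assms
  unfolding streaming_local_search_def by blast

section \<open>Charging the rejected elements of \<open>OPT\<close>\<close>

lemma sum_rejected_le:
  assumes inv: "invariant X S A \<chi> U w" and l: "l \<in> L"
  shows "(\<Sum>x\<in>(OPT - A) \<inter> E l. w x l) \<le> (\<Sum>e\<in>U l. current_value S \<chi> e)"
proof -
  interpret M: matroid "E l" "\<I> l" using matroid[OF l] .
  have feas: "feasible X L E \<I> S" and SA: "S \<subseteq> A" and AX: "A \<subseteq> X"
    using inv feasible_Init by (auto simp: invariant_def feasible_def)
  have w: "0 \<le> w x l" for x using inv by (auto simp: invariant_def)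
  have UE: "U l \<subseteq> A \<inter> E l" using inv l by (auto simp: invariant_def)
  have OPTX: "OPT \<subseteq> X" using feasible_subset[OF feasible_OPT] .
  have fin: "finite (U l)" "finite OPT" using UE AX OPTX finite_subset_X by (blast, blast)
  let ?R = "{x \<in> (OPT - A) \<inter> E l. 0 < w x l}"
  \<comment> \<open>Zero weights are dropped because the spanning clause of the invariant speaks of
    positive weights only.\<close>
  have "(\<Sum>x\<in>(OPT - A) \<inter> E l. w x l) = (\<Sum>x\<in>?R. w x l)"
    using fin w by (intro sum.mono_neutral_right) (auto simp: order.strict_iff_order)
  also have "\<dots> \<le> (\<Sum>e\<in>U l. current_value S \<chi> e)"
  proof (rule sum_le_of_card_superlevel_le)
    show "0 \<le> current_value S \<chi> e" if "e \<in> U l" for e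
      using that UE AX inv SA by (auto simp: current_value_def invariant_def intro!: incr_value_nonneg)
    fix \<theta> :: real assume "0 < \<theta>"
    let ?O = "{x \<in> ?R. \<theta> \<le> w x l}" and ?V = "{e \<in> U l. \<theta> \<le> current_value S \<chi> e}"
    \<comment> \<open>As part of \<open>OPT\<close>, \<open>?O\<close> is independent. Each of its
      elements is spanned at its own weight, hence also by the larger set of elements of value at
      least \<open>\<theta>\<close>.\<close>
    show "card ?O \<le> card ?V"
    proof (rule M.card_le_of_subset_cl)
      show "?O \<in> \<I> l"
        by (rule M.hereditary[of "OPT \<inter> E l"]) (use feasible_OPT l in \<open>auto simp: feasible_def\<close>)
      show "?O \<subseteq> M.cl ?V"
      proof
        fix x assume x: "x \<in> ?O"
        then have "x \<in> M.cl {e \<in> U l. w x l \<le> current_value S \<chi> e}"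
          using inv l OPTX by (auto simp: invariant_def)
        moreover have "M.cl {e \<in> U l. w x l \<le> current_value S \<chi> e} \<subseteq> M.cl ?V"
          using x UE by (intro M.cl_mono) auto
        ultimately show "x \<in> M.cl ?V" by blast
      qed
    qed (use fin in auto)
  qed (use fin in auto)
  finally show ?thesis .
qed

text \<open>A removed element is missing from \<open>U l\<close> for at least one of the at most \<open>p\<close> matroids that
  contain it, whence the factor \<open>p - 1\<close>.\<close>

lemma sum_rejected_total_le:
  assumes inv: "invariant X S A \<chi> U w"
  shows "(\<Sum>x\<in>OPT - A. \<Sum>l | l \<in> L \<and> x \<in> E l. w x l)
           \<le> real p * f S + (real p - 1) * sum \<chi> (A - S)"
proof -
  have feas: "feasible X L E \<I> S" and SA: "S \<subseteq> A" and AX: "A \<subseteq> X"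
    using inv feasible_Init by (auto simp: invariant_def feasible_def)
  have SX: "S \<subseteq> X" using SA AX by blast
  have OPTX: "OPT \<subseteq> X" using feasible_subset[OF feasible_OPT] .
  have fin: "finite A" "finite OPT" using AX OPTX finite_subset_X by (blast, blast)
  \<comment> \<open>The index set \<open>L\<close> may be infinite, but only matroids with nonempty
    ground set contribute. Finiteness of \<open>X\<close> and of each multiplicity leaves finitely
    many, so the sums can be exchanged.\<close>
  define L' where "L' = {l \<in> L. E l \<noteq> {}}"
  have "L' = (\<Union>x\<in>X. {l \<in> L. x \<in> E l})" using ground_subset by (auto simp: L'_def)
  then have finL: "finite L'" using finite_X multiplicity by auto
  have UA: "U l \<subseteq> A" "U l \<subseteq> E l" if "l \<in> L'" for l
    using inv that by (auto simp: invariant_def L'_def)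
  let ?v = "current_value S \<chi>"
  have v: "0 \<le> ?v e" if "e \<in> A" for e
    using that SX inv by (auto simp: current_value_def invariant_def intro!: incr_value_nonneg)
  have "(\<Sum>x\<in>OPT - A. \<Sum>l | l \<in> L \<and> x \<in> E l. w x l)
      = (\<Sum>x\<in>OPT - A. \<Sum>l | l \<in> L' \<and> x \<in> E l. w x l)"
    by (intro sum.cong) (auto simp: L'_def)
  also have "\<dots> = (\<Sum>l\<in>L'. \<Sum>x | x \<in> OPT - A \<and> x \<in> E l. w x l)"
    using fin finL by (intro sum.swap_restrict) auto
  also have "\<dots> = (\<Sum>l\<in>L'. \<Sum>x\<in>(OPT - A) \<inter> E l. w x l)"
    by (simp add: Int_def)
  also have "\<dots> \<le> (\<Sum>l\<in>L'. \<Sum>e\<in>U l. ?v e)"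
    by (intro sum_mono sum_rejected_le[OF inv]) (auto simp: L'_def)
  also have "\<dots> = (\<Sum>l\<in>L'. \<Sum>e | e \<in> A \<and> e \<in> U l. ?v e)"
    using UA by (intro sum.cong) auto
  also have "\<dots> = (\<Sum>e\<in>A. \<Sum>l | l \<in> L' \<and> e \<in> U l. ?v e)"
    using fin finL by (intro sum.swap_restrict) auto
  also have "\<dots> = (\<Sum>e\<in>A. real (card {l \<in> L'. e \<in> U l}) * ?v e)" by simp
  also have "\<dots> \<le> (\<Sum>e\<in>A. (if e \<in> S then real p else real p - 1) * ?v e)"
  proof (intro sum_mono mult_right_mono v)
    fix e assume e: "e \<in> A"
    have deg: "finite {l \<in> L. e \<in> E l}" "card {l \<in> L. e \<in> E l} \<le> p"
      using multiplicity e AX by auto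
    have sub: "{l \<in> L'. e \<in> U l} \<subseteq> {l \<in> L. e \<in> E l}" using UA by (auto simp: L'_def)
    show "real (card {l \<in> L'. e \<in> U l}) \<le> (if e \<in> S then real p else real p - 1)"
    proof (cases "e \<in> S")
      case True
      then show ?thesis using card_mono[OF deg(1) sub] deg(2) by simp
    next
      case False
      then obtain l where "l \<in> L" "e \<in> E l - U l" using inv e unfolding invariant_def by blast
      then have "{l \<in> L'. e \<in> U l} \<subset> {l \<in> L. e \<in> E l}" using sub by auto
      then have "card {l \<in> L'. e \<in> U l} < card {l \<in> L. e \<in> E l}"
        by (rule psubset_card_mono[OF deg(1)])
      then show ?thesis using deg(2) False by simp
    qed
  qed
  also have "\<dots> = (\<Sum>e\<in>S. real p * \<nu> e S) + (\<Sum>e\<in>A - S. (real p - 1) * \<chi> e)"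
  proof -
    have "(\<Sum>e\<in>A. (if e \<in> S then real p else real p - 1) * ?v e)
      = (\<Sum>e\<in>A - S. (if e \<in> S then real p else real p - 1) * ?v e)
        + (\<Sum>e\<in>S. (if e \<in> S then real p else real p - 1) * ?v e)"
      using SA fin by (intro sum.subset_diff) auto
    then show ?thesis by (simp add: current_value_def)
  qed
  also have "\<dots> = real p * (f S - f {}) + (real p - 1) * sum \<chi> (A - S)"
    using sum_incr_value[OF SX order_facts[OF SX]] by (simp flip: sum_distrib_left)
  also have "\<dots> \<le> real p * f S + (real p - 1) * sum \<chi> (A - S)"
    using f_empty_nonneg by (intro add_right_mono mult_left_mono) auto
  finally show ?thesis .
qed

text \<open>Here \<open>T\<close> is the total frozen value of the removed elements; the
  \<open>obtains\<close> form hides the bookkeeping. The bound comes from adding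
  \<open>OPT - A\<close> to \<open>A\<close> and splitting each marginal into an
  \<open>\<alpha>\<close> share and the charges \<open>w x l\<close>.\<close>

lemma pass_bound:
  assumes "streaming_local_search f prec L E \<I> \<alpha> \<beta> Init xs S"
  obtains T where "0 \<le> T" "\<beta> * T \<le> f S - f Init" "p = 0 \<Longrightarrow> T = 0" "feasible X L E \<I> S"
    and "f OPT \<le> f S + T + real (card OPT) * \<alpha> + (1 + \<beta>) * (real p * f S + (real p - 1) * T)"
proof -
  obtain A \<chi> U w where inv: "invariant X S A \<chi> U w" using invariant_final[OF assms] .
  let ?T = "sum \<chi> (A - S)"
  have feas: "feasible X L E \<I> S" and AX: "A \<subseteq> X"
    using inv feasible_Init by (auto simp: invariant_def feasible_def)
  have OPTX: "OPT \<subseteq> X" using feasible_subset[OF feasible_OPT] .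
  have finO: "finite OPT" using OPTX finite_subset_X by blast
  \<comment> \<open>A removed element lies in some ground set, which \<open>p = 0\<close>
    excludes.\<close>
  have "A - S = {}" if "p = 0"
  proof (rule ccontr)
    assume "A - S \<noteq> {}"
    then obtain e l where "e \<in> A" "l \<in> {l \<in> L. e \<in> E l}"
      using inv unfolding invariant_def by blast
    then show False using multiplicity[of e] AX that by (metis card_0_eq empty_iff le_zero_eq subsetD)
  qed
  then have p0: "?T = 0" if "p = 0" using that by (simp only: sum.empty)
  have T: "0 \<le> ?T" using inv by (intro sum_nonneg) (auto simp: invariant_def)
  have "f OPT \<le> f (A \<union> (OPT - A))"
    using AX OPTX by (intro f_mono) auto
  also have "\<dots> \<le> f A + (\<Sum>x\<in>OPT - A. marginal f x A)"
    using AX OPTX by (intro f_union_le) auto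
  also have "\<dots> \<le> (f S + ?T) +
      (\<Sum>x\<in>OPT - A. \<alpha> + (1 + \<beta>) * (\<Sum>l | l \<in> L \<and> x \<in> E l. w x l))"
    using inv OPTX by (intro add_mono sum_mono) (auto simp: invariant_def)
  also have "\<dots> = f S + ?T + real (card (OPT - A)) * \<alpha>
      + (1 + \<beta>) * (\<Sum>x\<in>OPT - A. \<Sum>l | l \<in> L \<and> x \<in> E l. w x l)"
    by (simp add: sum.distrib sum_distrib_left)
  also have "\<dots> \<le> f S + ?T + real (card OPT) * \<alpha>
      + (1 + \<beta>) * (real p * f S + (real p - 1) * ?T)"
    using sum_rejected_total_le[OF inv] alpha_nonneg beta_pos finO
    by (intro add_mono mult_left_mono mult_right_mono) (auto intro: card_mono)
  finally show thesis using that[of ?T] T p0 feas inv by (auto simp: invariant_def)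
qed

end

section \<open>Several passes\<close>

text \<open>The three claims need a joint induction: a pretend order inherits the previous order on
  the previous output, and feasibility of that output places it inside \<open>X\<close>, where the
  previous order is linear.\<close>

lemma multipass_local_search_pass:
  assumes mat: "matchoid p X L E \<I>" and ms: "monotone_submodular X f"
    and "0 \<le> f {}" "0 \<le> \<alpha>" "feasible X L E \<I> OPT"
    and beta: "\<forall>j\<in>{1..d}. 0 < \<beta> j"
    and streams: "\<forall>j\<in>{1..d}. distinct (xs j) \<and> set (xs j) = X"
    and run: "multipass_local_search f L E \<I> \<alpha> \<beta> d xs S"
    and "j < d"
  shows "strict_linear_on (S j) (pretend_order xs S j) \<and> feasible X L E \<I> (S j) \<and>
    local_search_pass p X L E \<I> f (pretend_order xs S (Suc j)) \<alpha> (\<beta> (Suc j)) (S j) (xs (Suc j)) OPT"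
  using \<open>j < d\<close>
proof (induction j)
  have pass: "local_search_pass p X L E \<I> f (pretend_order xs S (Suc j)) \<alpha> (\<beta> (Suc j)) (S j)
      (xs (Suc j)) OPT"
    if lin: "strict_linear_on (S j) (pretend_order xs S j)" and feas: "feasible X L E \<I> (S j)"
      and j: "j < d" for j
  proof (intro local_search_pass.intro local_search_pass_axioms.intro mat ms)
    have str: "distinct (xs (Suc j))" "set (xs (Suc j)) = X" using streams j by auto
    then show "strict_linear_on X (pretend_order xs S (Suc j))"
      using strict_linear_on_pretend_step[OF lin] by fastforce
    fix ys x zs s
    assume "xs (Suc j) = ys @ x # zs" "x \<notin> S j" "s \<in> S j \<union> set ys"
    then show "pretend_order xs S (Suc j) s x"
      using arrives_before_append[of s ys x zs] by (auto simp: pretend_step_def)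
  qed (use assms j feas in auto)
  {
    case 0
    \<comment> \<open>The dummy order at \<open>0\<close> is vacuously linear on the empty
      set.\<close>
    have "S 0 = {}" using run by (simp add: multipass_local_search_def)
    then have "strict_linear_on (S 0) (pretend_order xs S 0)" "feasible X L E \<I> (S 0)"
      using matchoid.matroid[OF mat]
      by (auto simp: strict_linear_on_def irreflp_on_def transp_on_def totalp_on_def feasible_def
          intro: matroid.empty_indep)
    then show ?case using pass[of 0] 0 by blast
  next
    case (Suc j)
    then interpret local_search_pass p X L E \<I> f "pretend_order xs S (Suc j)" \<alpha> "\<beta> (Suc j)" "S j"
      "xs (Suc j)" OPT by simp
    have "Suc j \<in> {1..d}" using Suc.prems by auto
    then have "streaming_local_search f (pretend_order xs S (Suc j)) L E \<I> \<alpha> (\<beta> (Suc j)) (S j)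
        (xs (Suc j)) (S (Suc j))"
      using run unfolding multipass_local_search_def by fastforce
    then have feas: "feasible X L E \<I> (S (Suc j))" by (rule pass_bound)
    then have "strict_linear_on (S (Suc j)) (pretend_order xs S (Suc j))"
      using strict_linear_on_subset[OF linear] feasible_subset by blast
    then show ?case using pass[of "Suc j"] feas Suc.prems by blast
  }
qed

lemma multipass_bound:
  assumes "matchoid p X L E \<I>" "monotone_submodular X f"
    and "0 \<le> f {}" "0 \<le> \<alpha>" "feasible X L E \<I> OPT"
    and "\<forall>j\<in>{1..d}. 0 < \<beta> j"
    and "\<forall>j\<in>{1..d}. distinct (xs j) \<and> set (xs j) = X"
    and run: "multipass_local_search f L E \<I> \<alpha> \<beta> d xs S"
    and "j \<in> {1..d}"
  obtains T where "0 \<le> T" "\<beta> j * T \<le> f (S j) - f (S (j - 1))" "p = 0 \<Longrightarrow> T = 0"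
    and "f OPT \<le> f (S j) + T + real (card OPT) * \<alpha>
           + (1 + \<beta> j) * (real p * f (S j) + (real p - 1) * T)"
proof -
  have Suc: "Suc (j - 1) = j" using assms(9) by auto
  interpret local_search_pass p X L E \<I> f "pretend_order xs S j" \<alpha> "\<beta> j" "S (j - 1)" "xs j" OPT
    using multipass_local_search_pass[OF assms(1-8), of "j - 1"] assms(9) unfolding Suc by auto
  have "streaming_local_search f (pretend_order xs S j) L E \<I> \<alpha> (\<beta> j) (S (j - 1)) (xs j) (S j)"
    using run assms(9) unfolding multipass_local_search_def by blast
  then show thesis by (rule pass_bound) (rule that)
qed

theorem theorem1:
  fixes f :: "'a set \<Rightarrow> real"
    and X :: "'a set" and L :: "'l set"
    and E :: "'l \<Rightarrow> 'a set" and \<I> :: "'l \<Rightarrow> 'a set set"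
    and p d i k :: nat
    and \<alpha> \<gamma> \<delta> :: real and \<beta> :: "nat \<Rightarrow> real"
    and xs :: "nat \<Rightarrow> 'a list" and S :: "nat \<Rightarrow> 'a set" and OPT :: "'a set"
  assumes "matchoid p X L E \<I>"
    and "\<forall>A. A \<subseteq> X \<longrightarrow> 0 \<le> f A"
    and "mono_on (Pow X) f"
    and "submodular_on X f"
    and "k = matchoid_rank X L E \<I>"
    and "is_arg_max f (feasible X L E \<I>) OPT"
    and "0 \<le> \<alpha>"
    and "\<forall>j\<in>{1..d}. 0 < \<beta> j"
    and "\<forall>j\<in>{1..d}. distinct (xs j) \<and> set (xs j) = X"
    and "multipass_local_search f L E \<I> \<alpha> \<beta> d xs S"
    and "1 < i" and "i \<le> d"
    and "0 < f (S i)"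
    and "f OPT \<le> \<gamma> * f (S (i - 1))"
    and "\<delta> = f (S (i - 1)) / f (S i)"
  shows "f OPT \<le> min (\<gamma> * \<delta>)
                      ((real p / \<beta> i + real p - 1) * (1 - \<delta>) + real p + \<beta> i * real p + 1)
                    * f (S i) + real k * \<alpha>"
proof -
  have finX: "finite X" using assms(1) by (rule matchoid.finite_X)
  have ms: "monotone_submodular X f"
    using finX assms(3,4) by unfold_locales
  have OPT: "feasible X L E \<I> OPT" using assms(6) by (simp add: is_arg_max_def)
  have "finite {S. feasible X L E \<I> S}"
    by (rule finite_subset[of _ "Pow X"]) (auto simp: feasible_def finX)
  then have "card OPT \<le> k"
    unfolding assms(5) matchoid_rank_def using OPT by (intro Max_ge) auto
  then have k: "real (card OPT) * \<alpha> \<le> real k * \<alpha>"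
    using assms(7) by (intro mult_right_mono) auto
  have f0: "0 \<le> f {}" using assms(2) by simp
  have beta: "0 < \<beta> i" using assms(8,11,12) by auto
  have dS: "\<delta> * f (S i) = f (S (i - 1))" using assms(13,15) by simp
  note bound = multipass_bound[OF assms(1) ms f0 assms(7) OPT assms(8-10)]
  let ?b = "(real p / \<beta> i + real p - 1) * (1 - \<delta>) + real p + \<beta> i * real p + 1"
  have first: "f OPT \<le> \<gamma> * \<delta> * f (S i) + real k * \<alpha>"
  proof -
    have "\<gamma> * \<delta> * f (S i) = \<gamma> * f (S (i - 1))" using dS by (metis mult.assoc)
    moreover have "0 \<le> real k * \<alpha>" using assms(7) by simp
    ultimately show ?thesis using assms(14) by linarith
  qed
  have second: "f OPT \<le> ?b * f (S i) + real k * \<alpha>"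
  proof (cases "p = 0")
    case True
    \<comment> \<open>With \<open>p = 0\<close> the factor \<open>?b\<close> reduces to
      \<open>\<delta>\<close>, so the target is \<open>f (S (i - 1)) + real k * \<alpha>\<close>. By
      \<open>1 < i\<close>, \<open>i - 1\<close> is a genuine pass, and there
      \<open>T = 0\<close>.\<close>
    have "i - 1 \<in> {1..d}" using assms(11,12) by auto
    then obtain T where "T = 0" "f OPT \<le> f (S (i - 1)) + T + real (card OPT) * \<alpha>
           + (1 + \<beta> (i - 1)) * (real p * f (S (i - 1)) + (real p - 1) * T)"
      using bound[of "i - 1"] True by metis
    then show ?thesis using True k dS by simp
  next
    case False
    have "i \<in> {1..d}" using assms(11,12) by auto
    then obtain T where T: "0 \<le> T" "\<beta> i * T \<le> f (S i) - f (S (i - 1))"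
      and le: "f OPT \<le> f (S i) + T + real (card OPT) * \<alpha>
           + (1 + \<beta> i) * (real p * f (S i) + (real p - 1) * T)"
      using bound[of i] by metis
    let ?q = "real p / \<beta> i + real p - 1"
    have "0 \<le> real p / \<beta> i" "1 \<le> real p" using False beta by auto
    then have q: "0 \<le> ?q" by linarith
    \<comment> \<open>The total coefficient of \<open>T\<close> equals
      \<open>?q * \<beta> i\<close>, so the growth bound on \<open>\<beta> i * T\<close> can be
      inserted. This requires \<open>0 \<le> ?q\<close>, which is where \<open>p\<close> being
      positive enters.\<close>
    have "T + (1 + \<beta> i) * (real p - 1) * T = ?q * (\<beta> i * T)"
      using beta by (simp add: field_simps)
    also have "\<dots> \<le> ?q * (f (S i) - f (S (i - 1)))"
      using T(2) q by (intro mult_left_mono) auto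
    also have "f (S i) - f (S (i - 1)) = (1 - \<delta>) * f (S i)"
      using dS by (simp add: left_diff_distrib)
    also have "?q * \<dots> = ?q * (1 - \<delta>) * f (S i)" by (rule mult.assoc[symmetric])
    finally have "f OPT \<le> f (S i) + real (card OPT) * \<alpha> + (1 + \<beta> i) * (real p * f (S i))
        + ?q * (1 - \<delta>) * f (S i)"
      using le by (simp add: algebra_simps)
    then show ?thesis using k by (simp add: algebra_simps)
  qed
  show ?thesis using first second by (simp add: min_def)
qed

end
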